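(* Let $G$ be a finite undirected multigraph with $n$ edges $e_1,\dots,e_n$. For an admissible $S\subseteq E_{\pm n}$ let $G(S)=\{e_i \mid i\in S \text{ or } i^*\in S\}$, and call the edge $e_i\in G(S)$ negative if $i^*\in S$. Let $\mathcal{C}(G)$ be the family of admissible sets $S\subseteq E_{\pm n}$ such that either (1) $G(S)$ is a (single) cycle and there is an even number of negative edges in $G(S)$; or (2) $G(S)$ is a union of (single) cycles, there is an even number of negative edges in $G(S)$, and in each of these cycles there is an odd number of negative edges. Then $\mathcal{C}(G)$ is the collection of circuits of a symplectic matroid on $E_{\pm n}$.
   Context: $E_{\pm n}=[n]\cup[n]^*$ with $[n]^*=\{1^*,\dots,n^*\}$ and $*$ the involution $i\leftrightarrow i^*$; $S^*=\{s^*:s\in S\}$; $S$ is admissible if $S\cap S^*=\emptyset$. A linear ordering $<$ on $E_{\pm n}$ is admissible if $i<j$ implies $j^*<i^*$. For admissible $k$-sets $A=\{a_1<\dots<a_k\}$, $B=\{b_1<\dots<b_k\}$ set $A\le B$ iff $a_i\le b_i$ for all $i$. A symplectic matroid is a pair $(E_{\pm n};\mathcal{B})$ with $\mathcal{B}$ a non-empty family of equi-numerous admissible subsets of $E_{\pm n}$ such that for every admissible ordering, $\mathcal{B}$ has a unique maximal element in the induced order. Its collection of circuits is the family of minimal admissible subsets of $E_{\pm n}$ not contained in any member of $\mathcal{B}$; equivalently here, $\mathcal{B}$ is the family of maximal admissible subsets of $E_{\pm n}$ containing no member of the circuit family.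
   Formalization: C(G) need not be an antichain (four loops: {1*,2*} and {1*,2*,3*,4*} both lie in it), so the circuits are shown to be the inclusion-minimal members of C(G); the bases are the maximal admissible sets containing no member of C(G). *)

theory Defs
  imports Main
begin

section \<open>The signed ground set\<close>

text \<open>\<open>Plain i\<close> stands for \<open>i\<close> and \<open>Starred i\<close> for \<open>i\<^sup>*\<close>; \<open>idx\<close> forgets the star.\<close>

datatype elt = Plain (idx: nat) | Starred (idx: nat)

fun star :: "elt \<Rightarrow> elt" where
  "star (Plain i) = Starred i"
| "star (Starred i) = Plain i"

definition ground :: "nat \<Rightarrow> elt set" where
  "ground n = {x. idx x \<in> {1..n}}"

definition admissible :: "nat \<Rightarrow> elt set \<Rightarrow> bool" where
  "admissible n S \<longleftrightarrow> S \<subseteq> ground n \<and> S \<inter> star ` S = {}"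

text \<open>Linear orders are reflexive relations here, so \<open>i < j\<close> is \<open>(i, j) \<in> r - Id\<close>.\<close>

definition admissible_ordering :: "nat \<Rightarrow> elt rel \<Rightarrow> bool" where
  "admissible_ordering n r \<longleftrightarrow>
     linear_order_on (ground n) r \<and>
     (\<forall>i\<in>ground n. \<forall>j\<in>ground n. (i, j) \<in> r - Id \<longrightarrow> (star j, star i) \<in> r - Id)"

text \<open>
  The lists are the increasing enumerations of \<open>A\<close> and \<open>B\<close>; \<open>list_all2\<close> forces them to have
  the same length.
\<close>

definition induced_le :: "elt rel \<Rightarrow> elt set \<Rightarrow> elt set \<Rightarrow> bool" where
  "induced_le r A B \<longleftrightarrow>
     (\<exists>as bs. set as = A \<and> sorted_wrt (\<lambda>x y. (x, y) \<in> r - Id) as \<and>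
              set bs = B \<and> sorted_wrt (\<lambda>x y. (x, y) \<in> r - Id) bs \<and>
              list_all2 (\<lambda>a b. (a, b) \<in> r) as bs)"


section \<open>Symplectic matroids and their circuits\<close>

definition symplectic_matroid :: "nat \<Rightarrow> elt set set \<Rightarrow> bool" where
  "symplectic_matroid n \<B> \<longleftrightarrow>
     \<B> \<noteq> {} \<and>
     (\<forall>A\<in>\<B>. admissible n A) \<and>
     (\<forall>A\<in>\<B>. \<forall>B\<in>\<B>. card A = card B) \<and>
     (\<forall>r. admissible_ordering n r \<longrightarrow>
        (\<exists>!M. M \<in> \<B> \<and> (\<forall>A\<in>\<B>. induced_le r M A \<longrightarrow> A = M)))"

definition minimal_members :: "'a set set \<Rightarrow> 'a set set" where
  "minimal_members \<F> = {S \<in> \<F>. \<forall>T\<in>\<F>. T \<subseteq> S \<longrightarrow> T = S}"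

definition maximal_members :: "'a set set \<Rightarrow> 'a set set" where
  "maximal_members \<F> = {S \<in> \<F>. \<forall>T\<in>\<F>. S \<subseteq> T \<longrightarrow> T = S}"

definition circuits :: "nat \<Rightarrow> elt set set \<Rightarrow> elt set set" where
  "circuits n \<B> = minimal_members {S. admissible n S \<and> \<not> (\<exists>B\<in>\<B>. S \<subseteq> B)}"

definition bases_avoiding :: "nat \<Rightarrow> elt set set \<Rightarrow> elt set set" where
  "bases_avoiding n \<C> = maximal_members {S. admissible n S \<and> \<not> (\<exists>C\<in>\<C>. C \<subseteq> S)}"


section \<open>Multigraphs\<close>

text \<open>
  The edges are \<open>1, \<dots>, n\<close>, and \<open>ends i\<close> is the set of end vertices of edge \<open>i\<close>. A loop has a
  single end vertex; loops and parallel edges are allowed.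
\<close>

definition multigraph :: "'v set \<Rightarrow> nat \<Rightarrow> (nat \<Rightarrow> 'v set) \<Rightarrow> bool" where
  "multigraph V n ends \<longleftrightarrow>
     finite V \<and> (\<forall>i\<in>{1..n}. ends i \<subseteq> V \<and> card (ends i) \<in> {1, 2})"

text \<open>
  A cycle is given by its edge set. A loop is a cycle of length 1, and two parallel edges form
  a cycle of length 2; distinctness of \<open>es\<close> excludes traversing one edge back and forth.
\<close>

definition is_cycle :: "nat \<Rightarrow> (nat \<Rightarrow> 'v set) \<Rightarrow> nat set \<Rightarrow> bool" where
  "is_cycle n ends D \<longleftrightarrow>
     (\<exists>vs es. es \<noteq> [] \<and> length vs = length es \<and> distinct vs \<and> distinct es \<and>
        set es = D \<and> D \<subseteq> {1..n} \<and>
        (\<forall>j<length es. ends (es ! j) = {vs ! j, vs ! (Suc j mod length es)}))"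

definition edges_of :: "elt set \<Rightarrow> nat set" where
  "edges_of S = idx ` S"

definition negative_edges :: "elt set \<Rightarrow> nat set" where
  "negative_edges S = {i. Starred i \<in> S}"

text \<open>
  In the second case the cycles of the union may share vertices or edges, and there may be any
  positive number of them. The family is then not an antichain in general: for four loops it
  contains \<open>{1\<^sup>*, 2\<^sup>*}\<close> and \<open>{1\<^sup>*, 2\<^sup>*, 3\<^sup>*, 4\<^sup>*}\<close>.
\<close>

definition graph_circuits :: "nat \<Rightarrow> (nat \<Rightarrow> 'v set) \<Rightarrow> elt set set" where
  "graph_circuits n ends =
     {S. admissible n S \<and>
         (is_cycle n ends (edges_of S) \<and> even (card (negative_edges S)) \<or>
          (\<exists>K. K \<noteq> {} \<and> (\<forall>D\<in>K. is_cycle n ends D) \<and> edges_of S = \<Union>K \<and>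
               even (card (negative_edges S)) \<and>
               (\<forall>D\<in>K. odd (card (negative_edges S \<inter> D)))))}"

end

(*
  Work over the field with two elements. Give i the incidence vector of the edge e_i (zero for a
  loop) and i* the same vector plus one further basis vector e recording the sign. A nonempty
  admissible set has vector sum 0 iff its edges have even degree everywhere and the number of
  negative edges is even; so an admissible set contains a member of the circuit family iff its
  vectors are dependent: even edge sets are unions of cycles, and two distinct odd cycles have
  a nonempty even symmetric difference with an even number of negative edges.

  For an admissible order, the greedy choice from the top (take x unless x* is already taken or the
  vector of x is already spanned) gives a basis M that dominates every basis A: for an upper
  set U, |A \<inter> U| \<le> |M \<inter> U|. If e is in the span of M \<inter> U, then M \<inter> U spans U. Otherwise M meets
  every pair {x, x*} inside U, and the part of U without its partners lies above these pairs, so M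
  restricted to it spans it.
*)

theory Submission
  imports Defs "HOL-Library.Z2" "HOL-Library.Function_Algebras"
begin

section \<open>Families of vectors over the field with two elements\<close>

text \<open>With only two scalars a linear combination is a subset sum, so an abelian group whose
  relevant elements are their own negatives replaces a vector space. Independence concerns index
  sets: two indices with the same vector are dependent.\<close>

locale binary_vectors =
  fixes f :: "'a \<Rightarrow> 'b::ab_group_add"
  assumes double: "f x + f x = 0"
begin

definition spanned :: "'a set \<Rightarrow> 'b set" where
  "spanned S = sum f ` Pow S"

definition indep :: "'a set \<Rightarrow> bool" where
  "indep S \<longleftrightarrow> (\<forall>X\<subseteq>S. sum f X = 0 \<longrightarrow> X = {})"

lemma sum_double: "sum f X + sum f X = 0"
  by (simp add: sum.distrib [symmetric] double)

text \<open>The common part of \<open>X\<close> and \<open>Y\<close> is summed twice and cancels.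
  Addition of vectors thus becomes symmetric difference of index sets.\<close>

lemma sum_sym_diff:
  assumes "finite X" "finite Y"
  shows "sum f (sym_diff X Y) = sum f X + sum f Y"
proof -
  have "sum f (sym_diff X Y) = sum f (X - Y) + sum f (Y - X)"
    using assms by (subst sum.union_disjoint) auto
  moreover have "sum f X = sum f (X - Y) + sum f (X \<inter> Y)"
    using assms by (subst sum.union_disjoint [symmetric]) (auto intro: arg_cong [where f = "sum f"])
  moreover have "sum f Y = sum f (Y - X) + sum f (X \<inter> Y)"
    using assms by (subst sum.union_disjoint [symmetric]) (auto intro: arg_cong [where f = "sum f"])
  ultimately show ?thesis
    using sum_double [of "X \<inter> Y"] by (simp add: algebra_simps)
qed

lemma spanned_mono: "S \<subseteq> T \<Longrightarrow> spanned S \<subseteq> spanned T"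
  by (auto simp: spanned_def)

lemma spanned_base:
  assumes "x \<in> S" shows "f x \<in> spanned S"
proof -
  have "f x = sum f {x}" by simp
  then show ?thesis using assms unfolding spanned_def by blast
qed

lemma spanned_add:
  assumes "finite S" "u \<in> spanned S" "w \<in> spanned S"
  shows "u + w \<in> spanned S"
proof -
  obtain X Y where XY: "X \<subseteq> S" "Y \<subseteq> S" and uw: "u = sum f X" "w = sum f Y"
    using assms by (auto simp: spanned_def)
  have "u + w = sum f (sym_diff X Y)"
    using XY uw assms(1) by (simp add: sum_sym_diff finite_subset)
  then show ?thesis using XY unfolding spanned_def by blast
qed

lemma spanned_subset:
  assumes "finite S" "f ` T \<subseteq> spanned S"
  shows "spanned T \<subseteq> spanned S"
proof -
  have "sum f X \<in> spanned S" if "X \<subseteq> T" for X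
    using that
  proof (induction X rule: infinite_finite_induct)
    case (insert x F)
    then show ?case using assms by (auto intro!: spanned_add)
  qed (auto simp: spanned_def intro: image_eqI [where x = "{}"])
  then show ?thesis by (auto simp: spanned_def)
qed

lemma indep_mono: "indep T \<Longrightarrow> S \<subseteq> T \<Longrightarrow> indep S"
  by (auto simp: indep_def)

text \<open>Counting replaces an exchange argument: distinct subsets of an independent
  \<open>T\<close> have distinct sums, so \<open>2 ^ card T\<close> vectors lie in a span of at most
  \<open>2 ^ card S\<close> vectors.\<close>

lemma indep_card_le:
  assumes fin: "finite S" "finite T" and T: "indep T" and sub: "f ` T \<subseteq> spanned S"
  shows "card T \<le> card S"
proof -
  have "inj_on (sum f) (Pow T)"
  proof (rule inj_onI)
    fix X Y assume XY: "X \<in> Pow T" "Y \<in> Pow T" "sum f X = sum f Y"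
    then have "sum f (sym_diff X Y) = 0"
      using fin by (simp add: sum_sym_diff finite_subset sum_double)
    moreover have "sym_diff X Y \<subseteq> T" using XY by blast
    ultimately have "sym_diff X Y = {}" using T by (simp only: indep_def)
    then show "X = Y" by blast
  qed
  then have "2 ^ card T = card (spanned T)"
    using fin by (simp add: spanned_def card_image card_Pow)
  also have "\<dots> \<le> card (spanned S)"
    using fin spanned_subset [OF fin(1) sub] by (auto simp: spanned_def intro: card_mono)
  also have "\<dots> \<le> 2 ^ card S"
    using fin by (metis spanned_def card_Pow card_image_le finite_Pow_iff)
  finally show ?thesis by simp
qed

lemma indep_insert:
  assumes "finite S" "x \<notin> S" "indep S"
  shows "indep (insert x S) \<longleftrightarrow> f x \<notin> spanned S"
proof
  assume I: "indep (insert x S)"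
  show "f x \<notin> spanned S"
  proof
    assume "f x \<in> spanned S"
    then obtain X where X: "X \<subseteq> S" "f x = sum f X" by (auto simp: spanned_def)
    have "sum f (insert x X) = 0"
      using assms X finite_subset [OF X(1)] double [of x] by (subst sum.insert) auto
    then show False using I X unfolding indep_def by blast
  qed
next
  assume x: "f x \<notin> spanned S"
  show "indep (insert x S)"
    unfolding indep_def
  proof (intro allI impI)
    fix X assume X: "X \<subseteq> insert x S" "sum f X = 0"
    have "x \<notin> X"
    proof
      assume "x \<in> X"
      then have "f x + sum f (X - {x}) = 0"
        using X assms(1) by (metis finite.insertI finite_subset sum.remove)
      then have "f x = sum f (X - {x})"
        using double [of x] by (metis add_left_cancel)
      then show False using X x by (auto simp: spanned_def)
    qed
    then show "X = {}" using X assms(3) unfolding indep_def by blast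
  qed
qed

end


section \<open>Signed ground sets\<close>

lemma star_star [simp]: "star (star x) = x"
  by (cases x) auto

lemma idx_star [simp]: "idx (star x) = idx x"
  by (cases x) auto

lemma star_neq [simp]: "star x \<noteq> x" "x \<noteq> star x"
  by (cases x; auto)+

lemma idx_eq_iff: "idx x = idx y \<longleftrightarrow> x = y \<or> x = star y"
  by (cases x; cases y) auto

lemma star_in_ground [simp]: "star x \<in> ground n \<longleftrightarrow> x \<in> ground n"
  by (simp add: ground_def)

lemma finite_ground [simp]: "finite (ground n)"
proof -
  have "ground n \<subseteq> Plain ` {1..n} \<union> Starred ` {1..n}"
  proof
    fix x assume "x \<in> ground n"
    then show "x \<in> Plain ` {1..n} \<union> Starred ` {1..n}"
      by (cases x) (auto simp: ground_def)
  qed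
  then show ?thesis by (rule finite_subset) simp
qed

lemma admissible_iff:
  "admissible n S \<longleftrightarrow> S \<subseteq> ground n \<and> (\<forall>x\<in>S. star x \<notin> S)"
  unfolding admissible_def by blast

lemma admissible_mono: "admissible n T \<Longrightarrow> S \<subseteq> T \<Longrightarrow> admissible n S"
  by (auto simp: admissible_iff)

lemma finite_admissible: "admissible n S \<Longrightarrow> finite S"
  using finite_subset [OF _ finite_ground] by (auto simp: admissible_iff)

lemma inj_on_idx: "admissible n S \<Longrightarrow> inj_on idx S"
  by (auto simp: inj_on_def idx_eq_iff admissible_iff)

lemma finite_subset_maximal:
  assumes "P S" and "\<And>T. P T \<Longrightarrow> T \<subseteq> G" and "finite G"
  obtains B where "B \<in> maximal_members {T. P T}" "S \<subseteq> B"
proof -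
  have "finite {T. P T}"
    using assms(2,3) by (metis finite_Pow_iff finite_subset PowI mem_Collect_eq subsetI)
  from finite_has_maximal2 [OF this, of S] assms(1)
  obtain B where "P B" "S \<subseteq> B" "\<forall>T. P T \<longrightarrow> B \<subseteq> T \<longrightarrow> B = T" by auto
  then show thesis by (intro that) (auto simp: maximal_members_def)
qed


section \<open>The induced order\<close>

text \<open>Ranks count from the top, so larger elements have smaller rank.\<close>

definition top_rank :: "nat \<Rightarrow> elt rel \<Rightarrow> elt \<Rightarrow> nat" where
  "top_rank n r x = card {y \<in> ground n. (x, y) \<in> r - Id}"

locale admissible_order =
  fixes n :: nat and r :: "elt rel"
  assumes ord: "admissible_ordering n r"
begin

abbreviation rk :: "elt \<Rightarrow> nat" where "rk \<equiv> top_rank n r"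

lemma rel:
  shows r_trans: "trans r" and r_antisym: "antisym r"
    and r_refl: "x \<in> ground n \<Longrightarrow> (x, x) \<in> r"
    and r_total: "x \<in> ground n \<Longrightarrow> y \<in> ground n \<Longrightarrow> x \<noteq> y \<Longrightarrow> (x, y) \<in> r \<or> (y, x) \<in> r"
  using ord unfolding admissible_ordering_def linear_order_on_def partial_order_on_def
    preorder_on_def refl_on_def total_on_def by blast+

lemma rank_less:
  assumes "x \<in> ground n" "y \<in> ground n" "(x, y) \<in> r - Id"
  shows "rk y < rk x"
  unfolding top_rank_def
proof (rule psubset_card_mono)
  show "{z \<in> ground n. (y, z) \<in> r - Id} \<subset> {z \<in> ground n. (x, z) \<in> r - Id}"
    using assms r_trans r_antisym by (auto dest: transD antisymD)
qed simp

lemma rank_less_iff: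
  assumes "x \<in> ground n" "y \<in> ground n"
  shows "rk y < rk x \<longleftrightarrow> (x, y) \<in> r - Id"
  using rank_less [OF assms] rank_less [OF assms(2,1)] r_total [OF assms]
  by (cases "x = y") auto

lemma rank_inj: "inj_on rk (ground n)"
  by (rule inj_onI) (metis DiffI pair_in_Id_conv less_irrefl rank_less r_total)

lemma rank_le_iff:
  assumes "x \<in> ground n" "y \<in> ground n"
  shows "rk y \<le> rk x \<longleftrightarrow> (x, y) \<in> r"
  using rank_less_iff [OF assms] inj_onD [OF rank_inj _ assms] r_refl [OF assms(1)]
  by (cases "x = y") (auto simp: le_less)

lemma rank_star:
  assumes "x \<in> ground n" "y \<in> ground n" "rk x < rk y"
  shows "rk (star y) < rk (star x)"
  using assms ord by (auto simp: rank_less_iff admissible_ordering_def)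

text \<open>Initial segments of the ranking are upper sets of the order. For sets of equal size, the
  counts inside them determine the induced order, so explicit enumerations can be avoided
  later.\<close>

definition upper :: "nat \<Rightarrow> elt set" where
  "upper k = {x \<in> ground n. rk x < k}"

lemma finite_upper [simp]: "finite (upper k)"
  by (simp add: upper_def)

lemma sorted_enumeration:
  assumes "A \<subseteq> ground n"
  obtains as where "set as = A" "sorted_wrt (\<lambda>x y. (x, y) \<in> r - Id) as" "length as = card A"
proof -
  \<comment> \<open>Rank falls as elements grow, hence the reversal of the sorted list of
    ranks.\<close>
  define as where "as = map (inv_into A rk) (rev (sorted_list_of_set (rk ` A)))"
  have fin: "finite A" using assms by (rule finite_subset) simp
  have inj: "inj_on rk A" using rank_inj assms by (rule inj_on_subset)
  have "inv_into A rk ` rk ` A = A"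
    using inj by (simp add: inv_into_image_cancel)
  then have "set as = A" using fin by (simp add: as_def)
  moreover have "sorted_wrt (\<lambda>x y. (x, y) \<in> r - Id) as"
    unfolding as_def sorted_wrt_map sorted_wrt_rev
  proof (rule sorted_wrt_mono_rel [OF _ strict_sorted_list_of_set])
    fix i j assume ij: "i \<in> set (sorted_list_of_set (rk ` A))" "j \<in> set (sorted_list_of_set (rk ` A))" "i < j"
    then obtain x y where "x \<in> A" "y \<in> A" "i = rk x" "j = rk y" using fin by auto
    then show "(inv_into A rk j, inv_into A rk i) \<in> r - Id"
      using ij assms rank_less_iff [of y x] inj by auto
  qed
  moreover have "length as = card A"
    using fin inj by (simp add: as_def card_image)
  ultimately show thesis by (rule that)
qed

lemma sorted_distinct:
  "sorted_wrt (\<lambda>x y. (x, y) \<in> r - Id) as \<Longrightarrow> distinct as"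
  by (induction as) auto

text \<open>Whenever an entry of \<open>as\<close> lies in the upper set, the entry of
  \<open>bs\<close> at the same position is at least as large and lies there too.\<close>

lemma induced_le_card_upper:
  assumes "induced_le r A B" "A \<subseteq> ground n" "B \<subseteq> ground n"
  shows "card (A \<inter> upper k) \<le> card (B \<inter> upper k)"
proof -
  obtain as bs where a: "set as = A" "sorted_wrt (\<lambda>x y. (x, y) \<in> r - Id) as"
    and b: "set bs = B" "sorted_wrt (\<lambda>x y. (x, y) \<in> r - Id) bs"
    and le: "list_all2 (\<lambda>a b. (a, b) \<in> r) as bs"
    using assms(1) unfolding induced_le_def by blast
  have "length (filter (\<lambda>x. x \<in> upper k) as) \<le> length (filter (\<lambda>x. x \<in> upper k) bs)"
    using le assms(2,3) unfolding a(1) [symmetric] b(1) [symmetric]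
  proof (induction rule: list_all2_induct)
    case (Cons x xs y ys)
    then have "rk y \<le> rk x" by (simp add: rank_le_iff)
    with Cons show ?case by (auto simp: upper_def)
  qed simp
  moreover have "card (set xs \<inter> upper k) = length (filter (\<lambda>x. x \<in> upper k) xs)"
    if "distinct xs" for xs
    using that by (simp add: distinct_card [symmetric] Int_def)
  ultimately show ?thesis
    using a b sorted_distinct by metis
qed

lemma set_eq_if_card_upper:
  assumes "\<And>k. card (A \<inter> upper k) = card (B \<inter> upper k)" "A \<subseteq> ground n" "B \<subseteq> ground n"
  shows "A = B"
proof -
  \<comment> \<open>The upper sets grow by one element at a time, so membership of \<open>x\<close>
    shows as a jump of the count at its rank.\<close>
  have iff: "x \<in> C \<longleftrightarrow> card (C \<inter> upper (rk x)) < card (C \<inter> upper (Suc (rk x)))"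
    if C: "C \<subseteq> ground n" and x: "x \<in> ground n" for C x
  proof -
    have "upper (Suc (rk x)) = insert x (upper (rk x))"
      using x inj_onD [OF rank_inj] by (auto simp: upper_def less_Suc_eq)
    moreover have "x \<notin> upper (rk x)" by (simp add: upper_def)
    ultimately show ?thesis by (cases "x \<in> C") auto
  qed
  have "x \<in> A \<longleftrightarrow> x \<in> B" if "x \<in> ground n" for x
    using iff [OF assms(2) that] iff [OF assms(3) that] assms(1) by simp
  then show ?thesis using assms(2,3) by blast
qed

lemma induced_le_antisym:
  assumes "induced_le r A B" "induced_le r B A" "A \<subseteq> ground n" "B \<subseteq> ground n"
  shows "A = B"
  using assms by (intro set_eq_if_card_upper) (auto intro: antisym induced_le_card_upper)

text \<open>If position \<open>i\<close> violated the comparison, the upper set starting at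
  \<open>as ! i\<close> would contain at least \<open>card A - i\<close> elements of
  \<open>A\<close>, but only elements of \<open>B\<close> strictly after position \<open>i\<close>,
  which is one fewer.\<close>

lemma induced_le_if_card_upper:
  assumes A: "A \<subseteq> ground n" and B: "B \<subseteq> ground n" and card: "card A = card B"
    and le: "\<And>k. card (A \<inter> upper k) \<le> card (B \<inter> upper k)"
  shows "induced_le r A B"
proof -
  obtain as where a: "set as = A" "sorted_wrt (\<lambda>x y. (x, y) \<in> r - Id) as" "length as = card A"
    using sorted_enumeration [OF A] .
  obtain bs where b: "set bs = B" "sorted_wrt (\<lambda>x y. (x, y) \<in> r - Id) bs" "length bs = card B"
    using sorted_enumeration [OF B] .
  have "(as ! i, bs ! i) \<in> r" if i: "i < card A" for i
  proof (rule ccontr)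
    assume neg: "(as ! i, bs ! i) \<notin> r"
    have ai: "as ! i \<in> ground n" and bi: "bs ! i \<in> ground n"
      using i a b card A B nth_mem by auto
    let ?U = "upper (Suc (rk (as ! i)))"
    have "set (drop i as) \<subseteq> A \<inter> ?U"
    proof
      fix x assume "x \<in> set (drop i as)"
      then obtain j where j: "i \<le> j" "j < card A" "x = as ! j"
        using a(3) by (metis in_set_conv_nth length_drop nth_drop le_add1 add.commute less_diff_conv less_imp_le i)
      then have "x \<in> A" using a by (metis nth_mem)
      moreover have "(as ! i, x) \<in> r"
        using j a sorted_wrt_nth_less [OF a(2), of i j] ai r_refl by (cases "i = j") auto
      ultimately show "x \<in> A \<inter> ?U"
        using A ai by (auto simp: upper_def less_Suc_eq_le rank_le_iff)
    qed
    then have "card (set (drop i as)) \<le> card (A \<inter> ?U)" by (intro card_mono) auto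
    then have "card A - i \<le> card (A \<inter> ?U)"
      using a sorted_distinct by (simp add: distinct_card)
    also have "\<dots> \<le> card (B \<inter> ?U)" by (rule le)
    also have "B \<inter> ?U \<subseteq> set (drop (Suc i) bs)"
    proof
      fix x assume x: "x \<in> B \<inter> ?U"
      then obtain j where j: "j < card B" "x = bs ! j"
        using b by (metis IntD1 in_set_conv_nth)
      have "i < j"
      proof (rule ccontr)
        assume "\<not> i < j"
        then have "(x, bs ! i) \<in> r"
          using j i card b sorted_wrt_nth_less [OF b(2), of j i] bi r_refl by (cases "i = j") auto
        moreover have "(as ! i, x) \<in> r"
          using x ai by (auto simp: upper_def less_Suc_eq_le rank_le_iff)
        ultimately show False using neg r_trans by (meson transD)
      qed
      then show "x \<in> set (drop (Suc i) bs)"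
        using j b card nth_mem [of "j - Suc i" "drop (Suc i) bs"] by simp
    qed
    then have "card (B \<inter> ?U) \<le> card (set (drop (Suc i) bs))" by (intro card_mono) auto
    also have "\<dots> = card B - Suc i"
      using b sorted_distinct by (simp add: distinct_card)
    finally show False using i card by linarith
  qed
  then have "list_all2 (\<lambda>a b. (a, b) \<in> r) as bs"
    using a b card by (simp add: list_all2_conv_all_nth)
  then show ?thesis using a b unfolding induced_le_def by blast
qed

end


section \<open>Symplectic matroids from signed binary vectors\<close>

text \<open>The matroid argument needs only that starring translates every vector by one fixed
  \<open>e\<close>; graphs enter later through a particular choice of \<open>f\<close>.\<close>

locale signed_vectors = binary_vectors f for f :: "elt \<Rightarrow> 'b::ab_group_add" +
  fixes e :: 'b
  assumes f_star: "f (star x) = f x + e"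
begin

definition bases :: "nat \<Rightarrow> elt set set" where
  "bases n = maximal_members {S. admissible n S \<and> indep S}"

lemma e_eq: "e = f x + f (star x)"
  using f_star [of x] double [of x] by (simp add: add.assoc [symmetric])

lemma basesD:
  assumes "B \<in> bases n"
  shows "admissible n B" "indep B" "finite B" "B \<subseteq> ground n"
    "\<And>T. admissible n T \<Longrightarrow> indep T \<Longrightarrow> B \<subseteq> T \<Longrightarrow> T = B"
  using assms finite_admissible [of n B] by (auto simp: bases_def maximal_members_def admissible_iff)

lemma subset_basis:
  assumes "admissible n S" "indep S"
  obtains B where "B \<in> bases n" "S \<subseteq> B"
  using finite_subset_maximal [of "\<lambda>S. admissible n S \<and> indep S" S "ground n"] assms
  by (auto simp: bases_def admissible_iff)

lemma basis_spans_free_element: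
  assumes B: "B \<in> bases n" and x: "x \<in> ground n" "x \<notin> B" "star x \<notin> B"
  shows "f x \<in> spanned B"
proof (rule ccontr)
  assume "f x \<notin> spanned B"
  then have "indep (insert x B)"
    using B x by (simp add: indep_insert basesD)
  moreover have "admissible n (insert x B)"
    using basesD(1) [OF B] x by (auto simp: admissible_iff dest: arg_cong [where f = star])
  ultimately show False using basesD(5) [OF B] x by blast
qed

text \<open>If \<open>B\<close> misses some pair completely, maximality puts both vectors of the
  pair into its span, hence also their sum \<open>e\<close>. Then the partners of the elements of
  \<open>B\<close> are spanned as well.\<close>

lemma basis_alternative:
  assumes B: "B \<in> bases n"
  shows "card B = n \<or> f ` ground n \<subseteq> spanned B"
proof (cases "idx ` B = {1..n}")
  case True
  then show ?thesis
    using card_image [OF inj_on_idx [OF basesD(1) [OF B]]] by simp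
next
  case False
  moreover have "idx ` B \<subseteq> {1..n}"
    using basesD(4) [OF B] by (auto simp: ground_def)
  ultimately obtain i where i: "i \<in> {1..n}" "i \<notin> idx ` B"
    by blast
  have "Plain i \<in> ground n" "Starred i \<in> ground n" "Plain i \<notin> B" "Starred i \<notin> B"
    using i by (auto simp: ground_def image_iff)
  then have "f (Plain i) \<in> spanned B" "f (star (Plain i)) \<in> spanned B"
    using basis_spans_free_element [OF B] by auto
  then have e: "e \<in> spanned B"
    unfolding e_eq [of "Plain i"] using basesD(3) [OF B] by (intro spanned_add)
  have "f x \<in> spanned B" if "x \<in> ground n" for x
  proof -
    have "f (star (star x)) \<in> spanned B" if "star x \<in> B"
      unfolding f_star [of "star x"] using that e basesD(3) [OF B] by (intro spanned_add spanned_base)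
    then show ?thesis
      using basis_spans_free_element [OF B \<open>x \<in> ground n\<close>] spanned_base by auto
  qed
  then show ?thesis by blast
qed

text \<open>Either \<open>B\<close> already has the largest size possible for an admissible set, or
  it spans all vectors and counting applies.\<close>

lemma bases_equinumerous:
  assumes "A \<in> bases n" "B \<in> bases n"
  shows "card A = card B"
proof -
  have "card A \<le> card B" if "A \<in> bases n" "B \<in> bases n" for A B
  proof (cases "card B = n")
    case True
    have "card A = card (idx ` A)"
      using inj_on_idx [OF basesD(1) [OF that(1)]] by (simp add: card_image)
    also have "\<dots> \<le> card {1..n}"
      using basesD(4) [OF that(1)] by (intro card_mono) (auto simp: ground_def)
    finally show ?thesis using True by simp
  next
    case False
    then have "f ` A \<subseteq> spanned B"
      using basis_alternative [OF that(2)] basesD(4) [OF that(1)] by auto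
    then show ?thesis using that by (intro indep_card_le basesD) auto
  qed
  then show ?thesis using assms by (auto intro: antisym)
qed

section \<open>The greedy basis of an admissible order\<close>

lemma ex_greedy:
  fixes q :: "elt \<Rightarrow> nat"
  shows "\<exists>M. \<forall>x. x \<in> M \<longleftrightarrow> x \<in> ground n \<and> \<not> (star x \<in> M \<and> q (star x) < q x) \<and>
    f x \<notin> spanned {y \<in> M. q y < q x}"
proof -
  \<comment> \<open>Membership of \<open>x\<close> depends only on elements of smaller
    \<open>q\<close>, so well-founded recursion applies. Each comparison of \<open>q\<close>
    precedes the recursive call so that \<open>conj_cong\<close> can discharge the
    \<open>cut\<close>.\<close>
  define g where "g = wfrec (measure q) (\<lambda>g x. x \<in> ground n \<and> \<not> (q (star x) < q x \<and> g (star x)) \<and>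
    f x \<notin> spanned {y. q y < q x \<and> g y})"
  have g: "g x \<longleftrightarrow> x \<in> ground n \<and> \<not> (q (star x) < q x \<and> g (star x)) \<and>
    f x \<notin> spanned {y. q y < q x \<and> g y}" for x
    by (subst def_wfrec [OF g_def [THEN eq_reflection] wf_measure])
      (simp add: cut_def cong: conj_cong)
  show ?thesis
    by (intro exI [of _ "{x. g x}"] allI, unfold mem_Collect_eq, subst g) (simp only: conj_commute)
qed

end

text \<open>The assumption on \<open>M\<close> is the fixed-point form of the greedy choice. Since
  ranks count from the top, elements of smaller rank are treated first.\<close>

locale ordered_signed_vectors = signed_vectors f e + admissible_order n r
  for f :: "elt \<Rightarrow> 'b::ab_group_add" and e n r +
  fixes M :: "elt set"
  assumes greedy: "x \<in> M \<longleftrightarrow> x \<in> ground n \<and> \<not> (star x \<in> M \<and> rk (star x) < rk x) \<and>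
    f x \<notin> spanned {y \<in> M. rk y < rk x}"
begin

lemma greedy_ground: "M \<subseteq> ground n"
  using greedy by blast

lemma greedy_finite: "finite M"
  using finite_subset [OF greedy_ground] by simp

lemma greedy_star: "x \<in> M \<Longrightarrow> star x \<notin> M"
proof
  assume xM: "x \<in> M" "star x \<in> M"
  then have "rk x \<noteq> rk (star x)"
    using rank_inj greedy_ground by (metis inj_onD star_neq(1) subsetD)
  then show False
    using xM greedy [of x] greedy [of "star x"] by (metis linorder_neqE_nat star_star)
qed

text \<open>In a nonempty subset of \<open>M\<close> with sum zero, the element treated last would
  be spanned by earlier ones, so it would have been rejected. An element rejected for a reason other
  than its partner is spanned by \<open>M\<close>, which gives maximality.\<close>

lemma greedy_in_bases: "M \<in> bases n"
proof -
  have adm: "admissible n M"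
    using greedy_ground greedy_star by (auto simp: admissible_iff)
  have "indep M"
    unfolding indep_def
  proof (intro allI impI, rule ccontr)
    fix X assume X: "X \<subseteq> M" "sum f X = 0" "X \<noteq> {}"
    have fin: "finite X" using X(1) greedy_finite by (rule finite_subset)
    obtain x where x: "x \<in> X" "\<And>y. y \<in> X \<Longrightarrow> rk y \<le> rk x"
      using obtains_MAX [OF fin X(3), of rk] fin by (metis Max_ge finite_imageI imageI)
    have "f x + sum f (X - {x}) = 0" using X x fin by (metis sum.remove)
    then have "f x = sum f (X - {x})" using double [of x] by (metis add_left_cancel)
    moreover have "X - {x} \<subseteq> {y \<in> M. rk y < rk x}"
    proof
      fix y assume y: "y \<in> X - {x}"
      then have "rk y \<noteq> rk x"
        using inj_onD [OF rank_inj, of y x] x(1) X(1) greedy_ground by blast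
      then show "y \<in> {y \<in> M. rk y < rk x}"
        using x(2) [of y] y X(1) by auto
    qed
    ultimately have "f x \<in> spanned {y \<in> M. rk y < rk x}"
      by (auto simp: spanned_def)
    then show False using greedy [of x] x X(1) by blast
  qed
  moreover have "T = M" if T: "admissible n T" "indep T" "M \<subseteq> T" for T
  proof (rule ccontr)
    assume "T \<noteq> M"
    then obtain y where y: "y \<in> T" "y \<notin> M" using T by blast
    have "star y \<notin> M" "y \<in> ground n" using T y by (auto simp: admissible_iff)
    then have "f y \<in> spanned {z \<in> M. rk z < rk y}" using greedy [of y] y by blast
    then have "f y \<in> spanned M" using spanned_mono [of "{z \<in> M. rk z < rk y}" M] by blast
    moreover have "indep (insert y M)" using T y by (auto intro: indep_mono)
    ultimately show False
      using y indep_insert [OF greedy_finite y(2) \<open>indep M\<close>] by simp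
  qed
  ultimately show ?thesis
    using adm by (auto simp: bases_def maximal_members_def)
qed

text \<open>Both reasons for rejecting \<open>y\<close> refer to elements treated before
  \<open>y\<close>, and these lie in every upper set containing \<open>y\<close>.\<close>

lemma upper_alternative:
  assumes "y \<in> upper k" "y \<notin> M"
  shows "star y \<in> M \<inter> upper k \<or> f y \<in> spanned (M \<inter> upper k)"
proof -
  have "{z \<in> M. rk z < rk y} \<subseteq> M \<inter> upper k"
    using assms greedy_ground by (auto simp: upper_def)
  then show ?thesis
    using assms greedy [of y] spanned_mono [of "{z \<in> M. rk z < rk y}" "M \<inter> upper k"]
    by (fastforce simp: upper_def)
qed

lemma greedy_dominates:
  assumes A: "A \<in> bases n"
  shows "card (A \<inter> upper k) \<le> card (M \<inter> upper k)"
proof (cases "e \<in> spanned (M \<inter> upper k)")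
  case True
  \<comment> \<open>With \<open>e\<close> in the span, an element blocked by its partner is spanned
    too: its vector is that of the partner plus \<open>e\<close>.\<close>
  have "f y \<in> spanned (M \<inter> upper k)" if y: "y \<in> upper k" for y
  proof (cases "star y \<in> M \<inter> upper k")
    case star: True
    then have "f (star (star y)) \<in> spanned (M \<inter> upper k)"
      unfolding f_star [of "star y"] using True by (intro spanned_add spanned_base) auto
    then show ?thesis by simp
  next
    case False
    then show ?thesis using upper_alternative [OF y] spanned_base y by blast
  qed
  then show ?thesis
    using basesD [OF A] by (intro indep_card_le) (auto intro: indep_mono)
next
  case False
  define P where "P = {x \<in> upper k. star x \<in> upper k}"
  define Q where "Q = upper k - P"
  have finP: "finite P" and finQ: "finite Q" by (simp_all add: P_def Q_def)
  have split: "card (C \<inter> upper k) = card (C \<inter> P) + card (C \<inter> Q)" for C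
  proof -
    have "C \<inter> upper k = (C \<inter> P) \<union> (C \<inter> Q)" by (auto simp: P_def Q_def)
    moreover have "(C \<inter> P) \<inter> (C \<inter> Q) = {}" by (auto simp: Q_def)
    ultimately show ?thesis using finP finQ by (simp add: card_Un_disjoint)
  qed
  \<comment> \<open>If \<open>M\<close> missed this pair, both of its vectors, and hence their sum
    \<open>e\<close>, would lie in the span.\<close>
  have meets: "x \<in> M \<or> star x \<in> M" if x: "x \<in> P" for x
  proof (rule ccontr)
    assume "\<not> (x \<in> M \<or> star x \<in> M)"
    then have "f x \<in> spanned (M \<inter> upper k)" "f (star x) \<in> spanned (M \<inter> upper k)"
      using x upper_alternative [of x k] upper_alternative [of "star x" k] by (auto simp: P_def)
    then show False using False unfolding e_eq [of x] by (simp add: spanned_add)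
  qed
  \<comment> \<open>On \<open>P\<close> no linear algebra is used: the admissible set
    \<open>A\<close> takes at most one element of each pair, and \<open>M\<close> takes at least
    one.\<close>
  have "card (A \<inter> P) = card (idx ` (A \<inter> P))"
    using inj_on_idx [OF basesD(1) [OF A]] by (simp add: card_image inj_on_subset)
  also have "\<dots> \<le> card (idx ` P)" using finP by (intro card_mono) auto
  also have "idx ` P \<subseteq> idx ` (M \<inter> P)"
  proof
    fix i assume "i \<in> idx ` P"
    then obtain x where "x \<in> P" "i = idx x" by blast
    then show "i \<in> idx ` (M \<inter> P)"
      using meets [of x] by (auto simp: P_def image_iff intro: bexI [of _ x] bexI [of _ "star x"])
  qed
  then have "card (idx ` P) \<le> card (M \<inter> P)"
    using finP by (meson card_image_le card_mono finite_Int finite_imageI order_trans)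
  finally have P: "card (A \<inter> P) \<le> card (M \<inter> P)" .
  have "f y \<in> spanned (M \<inter> Q)" if y: "y \<in> Q" for y
  proof (cases "y \<in> M")
    case True
    then show ?thesis using y by (simp add: spanned_base)
  next
    case False
    have yg: "y \<in> upper k" "y \<in> ground n" "star y \<notin> upper k" using y by (auto simp: P_def Q_def upper_def)
    \<comment> \<open>Admissibility of the order puts all of \<open>Q\<close> above \<open>P\<close>.\<close>
    have above: "rk y < rk x" if x: "x \<in> P" for x
    proof -
      have "star x \<in> upper k" "x \<in> ground n" using x by (auto simp: P_def upper_def)
      then have "rk (star x) < rk (star y)" using yg by (auto simp: upper_def)
      then show ?thesis
        using rank_star [of "star x" "star y"] yg \<open>x \<in> ground n\<close> by simp
    qed
    \<comment> \<open>The partner of \<open>y\<close> is outside the upper set, hence below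
      \<open>y\<close>, so it cannot have blocked \<open>y\<close>; only the span condition
      remains.\<close>
    have "f y \<in> spanned {z \<in> M. rk z < rk y}"
      using greedy [of y] False yg by (auto simp: upper_def)
    moreover have "{z \<in> M. rk z < rk y} \<subseteq> M \<inter> Q"
      using above yg greedy_ground by (fastforce simp: Q_def upper_def)
    ultimately show ?thesis using spanned_mono by blast
  qed
  then have "card (A \<inter> Q) \<le> card (M \<inter> Q)"
    using basesD [OF A] finQ by (intro indep_card_le) (auto intro: indep_mono)
  then show ?thesis using P by (simp add: split)
qed

end

section \<open>The symplectic matroid of signed vectors\<close>

context signed_vectors
begin

lemma symplectic_matroid_bases: "symplectic_matroid n (bases n)"
  unfolding symplectic_matroid_def
proof (intro conjI allI impI ballI)
  have "admissible n {}" "indep {}"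
    by (auto simp: admissible_iff indep_def)
  then show "bases n \<noteq> {}" by (metis empty_iff subset_basis)
  show "admissible n A" if "A \<in> bases n" for A using that by (rule basesD)
  show "card A = card B" if "A \<in> bases n" "B \<in> bases n" for A B
    using that by (rule bases_equinumerous)
  fix r assume r: "admissible_ordering n r"
  obtain M where M: "\<forall>x. x \<in> M \<longleftrightarrow> x \<in> ground n \<and>
    \<not> (star x \<in> M \<and> top_rank n r (star x) < top_rank n r x) \<and>
    f x \<notin> spanned {y \<in> M. top_rank n r y < top_rank n r x}"
    using ex_greedy [of n "top_rank n r"] by (elim exE)
  interpret ordered_signed_vectors f e n r M
    by unfold_locales (rule r, rule M [rule_format])
  \<comment> \<open>\<open>M\<close> is the largest basis, not merely a maximal one; this yields
    uniqueness.\<close>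
  have le: "induced_le r A M" if "A \<in> bases n" for A
    by (intro induced_le_if_card_upper greedy_dominates bases_equinumerous [of _ n] basesD(4)
      that greedy_in_bases)
  show "\<exists>!M. M \<in> bases n \<and> (\<forall>A\<in>bases n. induced_le r M A \<longrightarrow> A = M)"
  proof (rule ex1I [of _ M], intro conjI ballI impI)
    show "M \<in> bases n" by (rule greedy_in_bases)
    show "A = M" if "A \<in> bases n" "induced_le r M A" for A
      by (intro induced_le_antisym that le basesD(4) [of _ n] greedy_in_bases)
    show "N = M" if "N \<in> bases n \<and> (\<forall>A\<in>bases n. induced_le r N A \<longrightarrow> A = N)" for N
      using that le greedy_in_bases by blast
  qed
qed

lemma circuits_bases:
  "circuits n (bases n) = minimal_members {S. admissible n S \<and> \<not> indep S}"
proof -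
  have "(\<exists>B\<in>bases n. S \<subseteq> B) \<longleftrightarrow> indep S" if "admissible n S" for S
    using that subset_basis basesD(2) indep_mono by metis
  then have "{S. admissible n S \<and> \<not> (\<exists>B\<in>bases n. S \<subseteq> B)} = {S. admissible n S \<and> \<not> indep S}"
    by blast
  then show ?thesis by (simp only: circuits_def)
qed

end


section \<open>Cycles and even edge sets\<close>

text \<open>A loop adds two to the degree of its vertex, which is zero modulo two; hence the
  restriction to edges with two ends.\<close>

definition incidence :: "(nat \<Rightarrow> 'v set) \<Rightarrow> nat \<Rightarrow> 'v \<Rightarrow> bit" where
  "incidence ends i v = of_bool (card (ends i) = 2 \<and> v \<in> ends i)"

text \<open>The binary cycle space, with its elements given as edge sets.\<close>

definition even_edges :: "nat \<Rightarrow> (nat \<Rightarrow> 'v set) \<Rightarrow> nat set \<Rightarrow> bool" where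
  "even_edges n ends F \<longleftrightarrow> F \<subseteq> {1..n} \<and> (\<forall>v. (\<Sum>i\<in>F. incidence ends i v) = 0)"

lemma even_edges_finite: "even_edges n ends F \<Longrightarrow> finite F"
  unfolding even_edges_def using finite_subset by blast

lemma bit_double: "(b::bit) + b = 0"
  by (cases b) simp_all

text \<open>For a loop the two equal terms cancel, so cycles of length one need no separate
  treatment.\<close>

lemma incidence_eq:
  assumes "ends i = {a, b}"
  shows "incidence ends i v = of_bool (v = a) + of_bool (v = b)"
  using assms by (cases "a = b") (auto simp: incidence_def card_insert_if)

lemma cycle_nonempty: "is_cycle n ends D \<Longrightarrow> D \<noteq> {}"
  by (auto simp: is_cycle_def)

lemma cycle_even:
  assumes "is_cycle n ends D"
  shows "even_edges n ends D"
proof -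
  obtain vs es where es: "es \<noteq> []" "distinct es" "set es = D" "D \<subseteq> {1..n}"
    and ends: "\<forall>j<length es. ends (es ! j) = {vs ! j, vs ! (Suc j mod length es)}"
    using assms unfolding is_cycle_def by blast
  obtain m where m: "length es = Suc m" using es(1) by (cases es) auto
  have "(\<Sum>i\<in>D. incidence ends i v) = 0" for v
  proof -
    define \<delta> :: "nat \<Rightarrow> bit" where "\<delta> j = of_bool (v = vs ! j)" for j
    have "(\<Sum>i\<in>D. incidence ends i v) = (\<Sum>j<length es. incidence ends (es ! j) v)"
      using es by (intro sum.reindex_bij_betw [symmetric] bij_betw_nth) auto
    also have "\<dots> = (\<Sum>j<length es. \<delta> j + \<delta> (Suc j mod length es))"
    proof (rule sum.cong)
      fix j assume "j \<in> {..<length es}"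
      then have "ends (es ! j) = {vs ! j, vs ! (Suc j mod length es)}" using ends by auto
      then show "incidence ends (es ! j) v = \<delta> j + \<delta> (Suc j mod length es)"
        unfolding \<delta>_def by (rule incidence_eq)
    qed simp
    \<comment> \<open>Each edge contributes its start and its end vertex. The sum over the ends is a
      cyclic rotation of the sum over the starts, so the two cancel.\<close>
    also have "\<dots> = (\<Sum>j<Suc m. \<delta> j) + (\<Sum>j<Suc m. \<delta> (Suc j mod Suc m))"
      unfolding m by (rule sum.distrib)
    also have "(\<Sum>j<Suc m. \<delta> (Suc j mod Suc m)) = (\<Sum>j<m. \<delta> (Suc j)) + \<delta> 0"
      by simp
    also have "\<dots> = (\<Sum>j<Suc m. \<delta> j)"
      by (subst sum.lessThan_Suc_shift) (rule add.commute)
    finally show ?thesis by (simp only: bit_double)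
  qed
  then show ?thesis using es(4) by (simp add: even_edges_def)
qed

section \<open>Paths and the existence of cycles\<close>

definition is_path :: "(nat \<Rightarrow> 'v set) \<Rightarrow> 'v list \<Rightarrow> nat list \<Rightarrow> bool" where
  "is_path ends vs es \<longleftrightarrow> length vs = Suc (length es) \<and> distinct vs \<and> distinct es \<and>
     (\<forall>j<length es. ends (es ! j) = {vs ! j, vs ! Suc j})"

text \<open>The new edge cannot occur in \<open>es\<close>, since both ends of every edge of the
  path are path vertices and \<open>u\<close> is not one.\<close>

lemma path_Cons:
  assumes "is_path ends (w # vs) es" "ends i = {u, w}" "u \<notin> set (w # vs)"
  shows "is_path ends (u # w # vs) (i # es)"
proof -
  have "i \<notin> set es"
  proof
    assume "i \<in> set es"
    then obtain j where "j < length es" "i = es ! j" by (metis in_set_conv_nth)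
    then have "u = (w # vs) ! j \<or> u = (w # vs) ! Suc j"
      using assms(1,2) by (auto simp: is_path_def)
    then show False
      using assms(1,3) \<open>j < length es\<close> nth_mem [of j "w # vs"] nth_mem [of "Suc j" "w # vs"]
      by (auto simp: is_path_def)
  qed
  then show ?thesis
    using assms unfolding is_path_def
    by (auto simp: nth_Cons split: nat.split)
qed

text \<open>The cycle is the segment of the path from \<open>w\<close> to the occurrence of
  \<open>u\<close>, closed by the edge \<open>i\<close>.\<close>

lemma path_close:
  assumes p: "is_path ends (w # vs) (d # es)" and "set (d # es) \<subseteq> {1..n}"
    and i: "ends i = {u, w}" "i \<noteq> d" "i \<in> {1..n}" "u \<noteq> w" and u: "u \<in> set vs"
  obtains D where "is_cycle n ends D" "D \<subseteq> insert i (set (d # es))"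
proof -
  let ?vs = "w # vs" and ?es = "d # es"
  have len: "length ?vs = Suc (length ?es)" and dv: "distinct ?vs" and de: "distinct ?es"
    and e: "\<And>j. j < length ?es \<Longrightarrow> ends (?es ! j) = {?vs ! j, ?vs ! Suc j}"
    using p unfolding is_path_def by blast+
  \<comment> \<open>The position \<open>k\<close> is counted in \<open>vs\<close>, so
    \<open>u\<close> sits at \<open>Suc k\<close> in \<open>w # vs\<close> and the segment has
    \<open>Suc k\<close> edges. For \<open>k = 0\<close> the result is a pair of parallel
    edges.\<close>
  obtain k where k: "k < length vs" "vs ! k = u" using u by (metis in_set_conv_nth)
  have k_le: "Suc k \<le> length ?es" using k len by simp
  \<comment> \<open>As the path vertices are distinct, \<open>d\<close> is the only path edge that
    contains \<open>w\<close>.\<close>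
  have i_new: "i \<notin> set ?es"
  proof
    assume "i \<in> set ?es"
    then obtain j where j: "j < length ?es" "?es ! j = i" by (metis in_set_conv_nth)
    then have "j \<noteq> 0" using i(2) by (metis nth_Cons_0)
    then have "?vs ! j \<noteq> ?vs ! 0" "?vs ! Suc j \<noteq> ?vs ! 0"
      using j(1) len by (simp_all only: nth_eq_iff_index_eq [OF dv] not_False_eq_True)
    moreover have "w \<in> ends (?es ! j)" using j(2) i(1) by simp
    ultimately show False unfolding e [OF j(1)] by auto
  qed
  define vs' es' where "vs' = take (Suc (Suc k)) ?vs" and "es' = take (Suc k) ?es @ [i]"
  have len': "length es' = Suc (Suc k)" "length vs' = Suc (Suc k)"
    using k_le k(1) by (simp_all add: vs'_def es'_def)
  have "ends (es' ! j) = {vs' ! j, vs' ! (Suc j mod length es')}" if "j < length es'" for j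
  proof (cases "j = Suc k")
    case True
    have "es' ! j = i" using True k_le by (simp add: es'_def nth_append)
    then show ?thesis using True len' k i(1) by (auto simp: vs'_def)
  next
    case False
    then have j: "j < Suc k" using that len' by simp
    then have "es' ! j = ?es ! j" using k_le by (simp add: es'_def nth_append del: take_Suc_Cons)
    moreover have "vs' ! j = ?vs ! j" "vs' ! Suc j = ?vs ! Suc j"
      using j by (simp_all add: vs'_def del: take_Suc_Cons)
    ultimately show ?thesis using e [of j] j k_le len' by simp
  qed
  moreover have "distinct vs'" "distinct es'" "set es' \<subseteq> insert i (set ?es)"
    using dv de i_new unfolding vs'_def es'_def
    by (auto dest: in_set_takeD simp del: take_Suc_Cons)
  ultimately have "is_cycle n ends (set es')"
    using len' assms(2) i(3) unfolding is_cycle_def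
    by (intro exI [of _ vs'] exI [of _ es']) auto
  then show thesis using \<open>set es' \<subseteq> insert i (set ?es)\<close> by (rule that)
qed

text \<open>A longest path in \<open>F\<close> can be left through a second edge at its end, by evenness; this edge
  leads back to the path.\<close>

lemma even_contains_cycle:
  assumes G: "multigraph V n ends" and F: "even_edges n ends F" "F \<noteq> {}"
  obtains D where "is_cycle n ends D" "D \<subseteq> F"
\<comment> \<open>A loop is already a cycle; without loops every edge of \<open>F\<close> has two
  distinct ends.\<close>
proof (cases "\<exists>i\<in>F. card (ends i) = 1")
  case True
  then obtain i a where i: "i \<in> F" "ends i = {a}" by (metis card_1_singletonE)
  then have "is_cycle n ends {i}"
    using F unfolding is_cycle_def even_edges_def
    by (intro exI [of _ "[a]"] exI [of _ "[i]"]) auto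
  then show thesis using i that by blast
next
  case False
  have sub: "F \<subseteq> {1..n}" and fin: "finite F"
    using F(1) even_edges_finite by (auto simp: even_edges_def)
  have card2: "card (ends i) = 2" if "i \<in> F" for i
    using G False that sub by (auto simp: multigraph_def)
  define P where "P m \<longleftrightarrow> (\<exists>vs es. is_path ends vs es \<and> set es \<subseteq> F \<and> length es = m)" for m
  obtain i a b where "i \<in> F" "ends i = {a, b}" "a \<noteq> b"
    using F(2) card2 by (metis card_2_iff ex_in_conv)
  then have "is_path ends [a, b] [i]" "set [i] \<subseteq> F" by (auto simp: is_path_def)
  then have P1: "P 1" unfolding P_def by fastforce
  have bound: "m \<le> card F" if "P m" for m
    using that fin by (auto simp: P_def is_path_def) (metis card_mono distinct_card)
  obtain m where m: "P m" "\<And>k. P k \<Longrightarrow> k \<le> m"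
    using P1 bound by (metis GreatestI_nat Greatest_le_nat)
  then have "m \<ge> 1" using P1 by blast
  then obtain vs0 es0 where p0: "is_path ends vs0 es0" "set es0 \<subseteq> F" "length es0 = m" "es0 \<noteq> []"
    using m(1) unfolding P_def by fastforce
  then obtain w vs d es where "vs0 = w # vs" "es0 = d # es"
    by (metis is_path_def length_Suc_conv neq_Nil_conv)
  then have p: "is_path ends (w # vs) (d # es)" "set (d # es) \<subseteq> F" "length (d # es) = m"
    using p0 by auto
  have d: "d \<in> F" "w \<in> ends d" using p by (auto simp: is_path_def)
  obtain i where i: "i \<in> F" "i \<noteq> d" "w \<in> ends i"
  proof (rule ccontr)
    assume no: "\<not> thesis"
    \<comment> \<open>Were \<open>d\<close> the only edge of \<open>F\<close> at \<open>w\<close>,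
      the degree there would be one.\<close>
    have "incidence ends i w = 0" if "i \<in> F - {d}" for i
      using no that \<open>\<And>i. \<lbrakk>i \<in> F; i \<noteq> d; w \<in> ends i\<rbrakk> \<Longrightarrow> thesis\<close> by (auto simp: incidence_def)
    then have "(\<Sum>i\<in>F. incidence ends i w) = incidence ends d w"
      using fin d(1) by (simp add: sum.remove)
    then show False
      using F(1) d card2 by (simp add: even_edges_def incidence_def)
  qed
  obtain u where u: "ends i = {u, w}" "u \<noteq> w"
    using i card2 [OF i(1)] by (metis card_2_iff doubleton_eq_iff insertE singletonD)
  have "u \<in> set vs"
  proof (rule ccontr)
    assume "u \<notin> set vs"
    then have "is_path ends (u # w # vs) (i # d # es)"
      using p u by (intro path_Cons) auto
    then have "P (Suc m)" using p i(1) unfolding P_def by fastforce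
    then show False using m(2) by fastforce
  qed
  then obtain D where "is_cycle n ends D" "D \<subseteq> insert i (set (d # es))"
    using path_close [OF p(1) _ u(1) i(2) _ u(2)] p(2) i(1) sub by blast
  then show thesis using that p(2) i(1) by blast
qed

lemma even_edges_Diff:
  assumes "even_edges n ends F" "even_edges n ends D" "D \<subseteq> F"
  shows "even_edges n ends (F - D)"
proof -
  have "(\<Sum>i\<in>F - D. incidence ends i v) = 0" for v
    using sum.subset_diff [OF assms(3) even_edges_finite [OF assms(1)], of "\<lambda>i. incidence ends i v"]
      assms by (simp add: even_edges_def)
  then show ?thesis using assms by (auto simp: even_edges_def)
qed

text \<open>Removing a cycle from an even set leaves a smaller even set, so cycles can be split off
  one by one.\<close>

lemma even_union_of_cycles:
  assumes "multigraph V n ends" "even_edges n ends F"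
  shows "\<exists>K. (\<forall>D\<in>K. is_cycle n ends D) \<and> F = \<Union>K"
  using even_edges_finite [OF assms(2)] assms(2)
proof (induction F rule: finite_psubset_induct)
  case (psubset F)
  show ?case
  proof (cases "F = {}")
    case True
    then show ?thesis by (intro exI [of _ "{}"]) auto
  next
    case False
    obtain D where D: "is_cycle n ends D" "D \<subseteq> F"
      by (rule even_contains_cycle [OF assms(1) psubset.prems False])
    have "F - D \<subset> F" using D cycle_nonempty by blast
    from psubset.IH [OF this even_edges_Diff [OF psubset.prems cycle_even [OF D(1)] D(2)]]
    obtain K where K: "\<forall>D\<in>K. is_cycle n ends D" "F - D = \<Union>K"
      by (elim exE conjE)
    have "F = \<Union>(insert D K)" unfolding Union_insert K(2) [symmetric] using D(2) by blast
    then show ?thesis using D(1) K(1) by (intro exI [of _ "insert D K"]) simp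
  qed
qed


section \<open>Graph circuits as linear dependences\<close>

text \<open>The option type adjoins a single coordinate to the vertex coordinates:
  \<open>None\<close> carries the sign, and its unit vector serves as \<open>e\<close>.\<close>

definition signed_vec :: "(nat \<Rightarrow> 'v set) \<Rightarrow> elt \<Rightarrow> 'v option \<Rightarrow> bit" where
  "signed_vec ends x u =
     (case u of None \<Rightarrow> of_bool (x = Starred (idx x)) | Some v \<Rightarrow> incidence ends (idx x) v)"

lemma signed_vectors_signed_vec: "signed_vectors (signed_vec ends) (\<lambda>u. of_bool (u = None))"
proof
  show "signed_vec ends x + signed_vec ends x = 0" for x
    by (rule ext) (simp add: bit_double)
  show "signed_vec ends (star x) = signed_vec ends x + (\<lambda>u. of_bool (u = None))" for x
    by (rule ext, cases x) (auto simp: signed_vec_def split: option.split)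
qed

lemma sum_fun_apply: "sum f X u = (\<Sum>x\<in>X. f x u)" for f :: "'a \<Rightarrow> 'c \<Rightarrow> 'b::comm_monoid_add"
  by (induction X rule: infinite_finite_induct) auto

lemma of_nat_bit_eq_0_iff: "(of_nat k :: bit) = 0 \<longleftrightarrow> even k"
  by (induction k) auto

lemma negative_edges_subset: "negative_edges S \<subseteq> edges_of S"
  by (force simp: negative_edges_def edges_of_def)

lemma finite_edges_of: "admissible n S \<Longrightarrow> finite (edges_of S)"
  by (simp add: edges_of_def finite_admissible)

text \<open>Admissibility makes \<open>idx\<close> injective on \<open>S\<close>, so a sum over
  signed elements is a sum over edges, and the coordinate \<open>None\<close> counts negative edges
  modulo two. Allowing a part \<open>D\<close> of the edges serves the symmetric difference of two
  cycles.\<close>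

lemma sum_signed_vec:
  assumes S: "admissible n S" and D: "D \<subseteq> edges_of S"
  shows "sum (signed_vec ends) {x \<in> S. idx x \<in> D} = 0 \<longleftrightarrow>
    (\<forall>v. (\<Sum>i\<in>D. incidence ends i v) = 0) \<and> even (card (negative_edges S \<inter> D))"
proof -
  define X where "X = {x \<in> S. idx x \<in> D}"
  have inj: "inj_on idx X"
    using inj_on_idx [OF S] by (rule inj_on_subset) (auto simp: X_def)
  have fin: "finite X" using finite_admissible [OF S] by (simp add: X_def)
  have img: "idx ` X = D" using D by (auto simp: X_def edges_of_def)
  have "sum (signed_vec ends) X (Some v) = (\<Sum>i\<in>D. incidence ends i v)" for v
    unfolding img [symmetric] sum_fun_apply
    by (simp add: sum.reindex [OF inj] signed_vec_def)
  moreover have "sum (signed_vec ends) X None = of_nat (card (negative_edges S \<inter> D))"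
  proof -
    have "negative_edges S \<inter> D = idx ` (X \<inter> {x. x = Starred (idx x)})"
      by (force simp: negative_edges_def X_def)
    moreover have "inj_on idx (X \<inter> {x. x = Starred (idx x)})"
      using inj by (rule inj_on_subset) auto
    ultimately have "card (negative_edges S \<inter> D) = card (X \<inter> {x. x = Starred (idx x)})"
      by (simp only: card_image)
    then show ?thesis
      using fin by (simp add: sum_fun_apply signed_vec_def)
  qed
  ultimately show ?thesis
    unfolding X_def [symmetric] fun_eq_iff split_option_all
    by (auto simp: of_nat_bit_eq_0_iff)
qed

lemma graph_circuit_iff_dependent:
  assumes G: "multigraph V n ends" and S: "admissible n S"
  shows "(\<exists>C\<in>graph_circuits n ends. C \<subseteq> S) \<longleftrightarrow>
    \<not> binary_vectors.indep (signed_vec ends) S"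
proof -
  interpret signed_vectors "signed_vec ends" "\<lambda>u. of_bool (u = None)"
    by (rule signed_vectors_signed_vec)
  let ?f = "signed_vec ends"
  show ?thesis
  proof
    assume "\<exists>C\<in>graph_circuits n ends. C \<subseteq> S"
    then obtain C where C: "C \<in> graph_circuits n ends" "C \<subseteq> S" by blast
    then have adm: "admissible n C" by (simp add: graph_circuits_def)
    have dep: "\<not> indep C" if X: "X \<subseteq> C" "X \<noteq> {}" "sum ?f X = 0" for X
      using X unfolding indep_def by blast
    from C(1) consider
        (cycle) "is_cycle n ends (edges_of C)" "even (card (negative_edges C))"
      | (union) K where "K \<noteq> {}" "\<forall>D\<in>K. is_cycle n ends D" "edges_of C = \<Union>K"
          "even (card (negative_edges C))" "\<forall>D\<in>K. odd (card (negative_edges C \<inter> D))"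
      unfolding graph_circuits_def by blast
    then have "\<not> indep C"
    proof cases
      case cycle
      have "sum ?f {x \<in> C. idx x \<in> edges_of C} = 0"
        using cycle cycle_even [OF cycle(1)] negative_edges_subset [of C]
        by (simp add: sum_signed_vec [OF adm] even_edges_def Int_absorb2)
      moreover have "{x \<in> C. idx x \<in> edges_of C} \<noteq> {}"
        using cycle_nonempty [OF cycle(1)] by (auto simp: edges_of_def)
      ultimately show ?thesis by (intro dep) auto
    next
      case union
      obtain D1 where D1: "D1 \<in> K" using union(1) by blast
      \<comment> \<open>A single cycle would have both an odd and an even number of negative
        edges.\<close>
      have "K \<noteq> {D1}"
        using union negative_edges_subset [of C] by (auto simp: Int_absorb2)
      then obtain D2 where D2: "D2 \<in> K" "D1 \<noteq> D2" using D1 by blast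
      \<comment> \<open>The signs of two distinct unbalanced cycles cancel on their symmetric difference.\<close>
      define D where "D = sym_diff D1 D2"
      have sub: "D1 \<subseteq> edges_of C" "D2 \<subseteq> edges_of C" using D1 D2 union(3) by blast+
      have fin: "finite D1" "finite D2" using sub finite_edges_of [OF adm] finite_subset by blast+
      have inter: "finite (negative_edges C \<inter> D1)" "finite (negative_edges C \<inter> D2)"
        using fin by auto
      interpret inc: binary_vectors "incidence ends"
        by unfold_locales (auto simp: fun_eq_iff bit_double)
      have "(\<Sum>i\<in>D. incidence ends i v) = 0" for v
      proof -
        have "sum (incidence ends) D v = 0"
          using inc.sum_sym_diff [OF fin] cycle_even [of n ends D1] cycle_even [of n ends D2]
            union(2) D1 D2 by (simp add: D_def sum_fun_apply even_edges_def)
        then show ?thesis by (simp add: sum_fun_apply)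
      qed
      moreover have "even (card (negative_edges C \<inter> D))"
      proof -
        let ?N = "negative_edges C"
        have "?N \<inter> D = (?N \<inter> D1 - D2) \<union> (?N \<inter> D2 - D1)" by (auto simp: D_def)
        moreover have "(?N \<inter> D1 - D2) \<inter> (?N \<inter> D2 - D1) = {}" by blast
        ultimately have "card (?N \<inter> D) = card (?N \<inter> D1 - D2) + card (?N \<inter> D2 - D1)"
          using inter by (simp only: card_Un_disjoint finite_Diff)
        moreover have "card (?N \<inter> D1) = card (?N \<inter> D1 - D2) + card (?N \<inter> D1 \<inter> D2)"
          using inter by (metis add.commute card_Int_Diff)
        moreover have "card (?N \<inter> D2) = card (?N \<inter> D2 - D1) + card (?N \<inter> D1 \<inter> D2)"
          using inter by (metis add.commute card_Int_Diff Int_assoc Int_commute)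
        moreover have "odd (card (?N \<inter> D1))" "odd (card (?N \<inter> D2))" using union(5) D1 D2 by auto
        ultimately show ?thesis by presburger
      qed
      moreover have DC: "D \<subseteq> edges_of C" using sub by (auto simp: D_def)
      ultimately have "sum ?f {x \<in> C. idx x \<in> D} = 0"
        by (simp add: sum_signed_vec [OF adm DC])
      moreover have "D \<noteq> {}" using D2 by (auto simp: D_def)
      then have "{x \<in> C. idx x \<in> D} \<noteq> {}" using DC by (auto simp: edges_of_def)
      ultimately show ?thesis by (intro dep) auto
    qed
    then show "\<not> indep S" using C(2) indep_mono by blast
  next
    assume "\<not> indep S"
    then obtain X where X: "X \<subseteq> S" "sum ?f X = 0" "X \<noteq> {}" unfolding indep_def by blast
    have adm: "admissible n X" using S X(1) by (rule admissible_mono)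
    have "{x \<in> X. idx x \<in> edges_of X} = X" by (auto simp: edges_of_def)
    then have zero: "\<forall>v. (\<Sum>i\<in>edges_of X. incidence ends i v) = 0"
      and neg: "even (card (negative_edges X))"
      using X(2) sum_signed_vec [OF adm order_refl, of ends] negative_edges_subset [of X]
      by (auto simp: Int_absorb2)
    have "edges_of X \<subseteq> {1..n}" using adm by (auto simp: admissible_iff ground_def edges_of_def)
    then have "even_edges n ends (edges_of X)" using zero by (simp add: even_edges_def)
    from even_union_of_cycles [OF G this]
    obtain K where K: "\<forall>D\<in>K. is_cycle n ends D" "edges_of X = \<Union>K"
      by (elim exE conjE)
    show "\<exists>C\<in>graph_circuits n ends. C \<subseteq> S"
    \<comment> \<open>A cycle with an even number of negative edges gives a member of the first kind
      inside \<open>X\<close>; if there is none, \<open>X\<close> itself is of the second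
      kind.\<close>
    proof (cases "\<exists>D\<in>K. even (card (negative_edges X \<inter> D))")
      case True
      then obtain D where D: "D \<in> K" "even (card (negative_edges X \<inter> D))" by blast
      define C where "C = {x \<in> X. idx x \<in> D}"
      have "edges_of C = D" using D(1) K(2) by (auto simp: C_def edges_of_def)
      moreover have "negative_edges C = negative_edges X \<inter> D"
        by (auto simp: C_def negative_edges_def)
      moreover have "admissible n C" using adm by (rule admissible_mono) (auto simp: C_def)
      ultimately have "C \<in> graph_circuits n ends"
        using D K(1) by (simp add: graph_circuits_def)
      moreover have "C \<subseteq> S" using X(1) by (auto simp: C_def)
      ultimately show ?thesis by blast
    next
      case False
      moreover have "K \<noteq> {}" using X(3) K(2) by (auto simp: edges_of_def)
      ultimately have "X \<in> graph_circuits n ends"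
        using adm neg K unfolding graph_circuits_def by blast
      then show ?thesis using X(1) by blast
    qed
  qed
qed

text \<open>A minimal set among those containing a member of the family must equal that member. This
  passes from all dependent admissible sets to the circuit family, which need not be an
  antichain.\<close>

lemma minimal_members_upward:
  assumes "\<And>C. C \<in> \<C> \<Longrightarrow> P C"
  shows "minimal_members {S. P S \<and> (\<exists>C\<in>\<C>. C \<subseteq> S)} = minimal_members \<C>"
proof (intro subset_antisym subsetI)
  fix S assume S: "S \<in> minimal_members {S. P S \<and> (\<exists>C\<in>\<C>. C \<subseteq> S)}"
  have eq: "C = S" if "C \<in> \<C>" "C \<subseteq> S" for C
    using S that assms unfolding minimal_members_def by blast
  moreover obtain C where "C \<in> \<C>" "C \<subseteq> S"
    using S unfolding minimal_members_def by blast
  ultimately show "S \<in> minimal_members \<C>" unfolding minimal_members_def by blast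
next
  fix S assume S: "S \<in> minimal_members \<C>"
  then have "P S" "S \<in> \<C>" using assms by (auto simp: minimal_members_def)
  moreover have "T = S" if "C \<in> \<C>" "C \<subseteq> T" "T \<subseteq> S" for C T
    using S that unfolding minimal_members_def by blast
  ultimately show "S \<in> minimal_members {S. P S \<and> (\<exists>C\<in>\<C>. C \<subseteq> S)}"
    unfolding minimal_members_def by blast
qed

theorem theorem4:
  fixes V :: "'v set" and n :: nat and ends :: "nat \<Rightarrow> 'v set"
  assumes "multigraph V n ends"
  shows "\<exists>\<B>. symplectic_matroid n \<B> \<and>
             \<B> = bases_avoiding n (graph_circuits n ends) \<and>
             circuits n \<B> = minimal_members (graph_circuits n ends)"
proof (intro exI conjI)
  interpret signed_vectors "signed_vec ends" "\<lambda>u. of_bool (u = None)"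
    by (rule signed_vectors_signed_vec)
  note dep = graph_circuit_iff_dependent [OF assms]
  \<comment> \<open>This fixes the witness: the maximal admissible sets that are independent for the
    signed incidence vectors.\<close>
  show "symplectic_matroid n (bases n)" by (rule symplectic_matroid_bases)
  show "bases n = bases_avoiding n (graph_circuits n ends)"
    unfolding bases_def bases_avoiding_def by (simp add: dep cong: conj_cong)
  have "circuits n (bases n) =
      minimal_members {S. admissible n S \<and> (\<exists>C\<in>graph_circuits n ends. C \<subseteq> S)}"
    unfolding circuits_bases by (simp add: dep cong: conj_cong)
  also have "\<dots> = minimal_members (graph_circuits n ends)"
    by (rule minimal_members_upward) (simp add: graph_circuits_def)
  finally show "circuits n (bases n) = minimal_members (graph_circuits n ends)" .
qed

end
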